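(* Let $u_\gamma$ be one of the Hermite, Laguerre or Jacobi weights, with Pearson data $p_2(x)=ax^2+bx+c$ and $p_{1,\gamma}(x)=(A_\gamma-2a)x+(B_\gamma-b)$, and let $u_{\gamma+1}=p_2u_\gamma$. The $LU$ factorization of the Gram matrices of the classical weights leads to $$S_\gamma DS_{\gamma+1}^{-1}=-H_\gamma\Big(S_{\gamma+1}\big(p_2'(\Lambda)+p_{1,\gamma}(\Lambda)+Dp_2(\Lambda)\big)S_\gamma^{-1}\Big)^\top H_{\gamma+1}^{-1}.$$ Equivalently, $$(S_\gamma)_{n+1,n}=(n+1)\frac{B_\gamma+nb}{A_\gamma+2na}\quad(n\ge0),\qquad (H_\gamma)_n=\frac{-n}{A_\gamma+(n-1)a}(H_{\gamma+1})_{n-1}\quad(n\ge1).$$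
   Context: The weights are: Hermite $u(x)=e^{-x^2}$ on $\mathbb{R}$, with $p_1=-2x$, $p_2=1$; Laguerre $u_\alpha(x)=x^\alpha e^{-x}$ on $(0,\infty)$, $\alpha>-1$, with $p_{1,\alpha}=\alpha-x$, $p_2=x$; Jacobi $u_{\alpha,\beta}(x)=(1-x)^\alpha(1+x)^\beta$ on $(-1,1)$, $\alpha,\beta>-1$, with $p_{1,\alpha,\beta}=-[(\alpha-\beta)+(\alpha+\beta)x]$, $p_2=1-x^2$. They satisfy $p_2u_\gamma'=p_{1,\gamma}u_\gamma$; $\gamma$ denotes the parameters (none, $\alpha$, or $(\alpha,\beta)$), and $\gamma+1$ means that all parameters are increased by one (no change for Hermite), so that $u_{\gamma+1}=p_2u_\gamma$. The moment matrix $(G_\gamma)_{i,j}=\int x^{i+j}u_\gamma(x)\,dx$, $i,j\ge0$, factors uniquely as $G_\gamma=S_\gamma^{-1}H_\gamma S_\gamma^{-\top}$ with $S_\gamma$ lower unitriangular and $H_\gamma=\operatorname{diag}((H_\gamma)_0,(H_\gamma)_1,\dots)$. $\Lambda$ is the shift matrix $\Lambda_{i,j}=\delta_{i+1,j}$, and $D$ is the semi-infinite matrix with $D_{n,n-1}=n$ for $n\ge1$ and zeros elsewhere. *)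

theory Defs
  imports "HOL-Analysis.Analysis" "HOL-Library.Function_Algebras"
    "HOL-Computational_Algebra.Polynomial"
begin

text \<open>
  Semi-infinite matrices are functions of a row and a column index, counted from 0.
  Addition and negation are the pointwise ones of \<^theory>\<open>HOL-Library.Function_Algebras\<close>; the
  pointwise product of that theory is never used. The series in the product below has only finitely
  many nonzero terms whenever the left factor has finitely supported rows or the right factor has
  finitely supported columns, as is the case for every product formed here.
\<close>

type_synonym smat = "nat \<Rightarrow> nat \<Rightarrow> real"

definition smat_mult :: "smat \<Rightarrow> smat \<Rightarrow> smat"  (infixl \<open>\<odot>\<close> 70) where
  "M \<odot> N = (\<lambda>i j. \<Sum>k. M i k * N k j)"

definition smat_transpose :: "smat \<Rightarrow> smat" where
  "smat_transpose M = (\<lambda>i j. M j i)"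

definition smat_diag :: "(nat \<Rightarrow> real) \<Rightarrow> smat" where
  "smat_diag h = (\<lambda>i j. if i = j then h i else 0)"

definition smat_id :: smat where
  "smat_id = smat_diag (\<lambda>_. 1)"

text \<open>
  A two-sided inverse of a semi-infinite matrix need not be unique in general. It is only taken of
  lower unitriangular matrices and of diagonal matrices with nonzero diagonal, where it
  exists and the equation \<open>M \<odot> N = smat_id\<close> alone already determines \<open>N\<close>.
\<close>

definition smat_inv :: "smat \<Rightarrow> smat" where
  "smat_inv M = (THE N. M \<odot> N = smat_id \<and> N \<odot> M = smat_id)"

definition lower_unitriangular :: "smat \<Rightarrow> bool" where
  "lower_unitriangular M \<longleftrightarrow> (\<forall>i. M i i = 1) \<and> (\<forall>i j. i < j \<longrightarrow> M i j = 0)"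

primrec smat_pow :: "smat \<Rightarrow> nat \<Rightarrow> smat" where
  "smat_pow M 0 = smat_id"
| "smat_pow M (Suc k) = M \<odot> smat_pow M k"

definition smat_poly :: "real poly \<Rightarrow> smat \<Rightarrow> smat" where
  "smat_poly p M = (\<lambda>i j. \<Sum>k\<le>degree p. coeff p k * smat_pow M k i j)"

definition shift_mat :: smat where
  "shift_mat = (\<lambda>i j. if j = i + 1 then 1 else 0)"

definition deriv_mat :: smat where
  "deriv_mat = (\<lambda>i j. if i = j + 1 then real i else 0)"

text \<open>A classical weight together with its parameters: the index \<open>\<gamma>\<close>.\<close>

datatype classical = Hermite | Laguerre real | Jacobi real real

fun admissible :: "classical \<Rightarrow> bool" where
  "admissible Hermite \<longleftrightarrow> True"
| "admissible (Laguerre \<alpha>) \<longleftrightarrow> \<alpha> > -1"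
| "admissible (Jacobi \<alpha> \<beta>) \<longleftrightarrow> \<alpha> > -1 \<and> \<beta> > -1"

fun weight_interval :: "classical \<Rightarrow> real set" where
  "weight_interval Hermite = UNIV"
| "weight_interval (Laguerre \<alpha>) = {0<..}"
| "weight_interval (Jacobi \<alpha> \<beta>) = {-1<..<1}"

fun weight :: "classical \<Rightarrow> real \<Rightarrow> real" where
  "weight Hermite x = exp (- (x ^ 2))"
| "weight (Laguerre \<alpha>) x = x powr \<alpha> * exp (- x)"
| "weight (Jacobi \<alpha> \<beta>) x = (1 - x) powr \<alpha> * (1 + x) powr \<beta>"

fun pearson1 :: "classical \<Rightarrow> real poly" where
  "pearson1 Hermite = [:0, -2:]"
| "pearson1 (Laguerre \<alpha>) = [:\<alpha>, -1:]"
| "pearson1 (Jacobi \<alpha> \<beta>) = [:- (\<alpha> - \<beta>), - (\<alpha> + \<beta>):]"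

fun pearson2 :: "classical \<Rightarrow> real poly" where
  "pearson2 Hermite = 1"
| "pearson2 (Laguerre \<alpha>) = [:0, 1:]"
| "pearson2 (Jacobi \<alpha> \<beta>) = [:1, 0, -1:]"

fun incr_params :: "classical \<Rightarrow> classical" where
  "incr_params Hermite = Hermite"
| "incr_params (Laguerre \<alpha>) = Laguerre (\<alpha> + 1)"
| "incr_params (Jacobi \<alpha> \<beta>) = Jacobi (\<alpha> + 1) (\<beta> + 1)"

lemma weight_interval_incr_params: "weight_interval (incr_params \<gamma>) = weight_interval \<gamma>"
  by (cases \<gamma>) auto

lemma weight_incr_params:
  assumes "x \<in> weight_interval \<gamma>"
  shows "weight (incr_params \<gamma>) x = poly (pearson2 \<gamma>) x * weight \<gamma> x"
  using assms by (cases \<gamma>) (auto simp: powr_add algebra_simps)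

lemma weight_pearson:
  assumes "x \<in> weight_interval \<gamma>"
  shows "\<exists>d. (weight \<gamma> has_real_derivative d) (at x) \<and>
             poly (pearson2 \<gamma>) x * d = poly (pearson1 \<gamma>) x * weight \<gamma> x"
proof (cases \<gamma>)
  case Hermite
  have "((\<lambda>x. exp (- (x ^ 2))) has_real_derivative (-2 * x * exp (- (x ^ 2)))) (at x)"
    by (auto intro!: derivative_eq_intros)
  moreover have "weight \<gamma> = (\<lambda>x. exp (- (x ^ 2)))"
    using Hermite by auto
  ultimately show ?thesis
    using Hermite by (intro exI[of _ "-2 * x * exp (- (x ^ 2))"]) simp
next
  case (Laguerre \<alpha>)
  then have x: "x > 0"
    using assms by auto
  then have "((\<lambda>x. x powr \<alpha> * exp (- x)) has_real_derivative
      (\<alpha> / x - 1) * (x powr \<alpha> * exp (- x))) (at x)"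
    by (auto intro!: derivative_eq_intros simp: powr_diff field_simps)
  moreover have "weight \<gamma> = (\<lambda>x. x powr \<alpha> * exp (- x))"
    using Laguerre by auto
  ultimately show ?thesis
    using Laguerre x
    by (intro exI[of _ "(\<alpha> / x - 1) * (x powr \<alpha> * exp (- x))"]) (simp add: field_simps)
next
  case (Jacobi \<alpha> \<beta>)
  then have x: "1 - x > 0" "1 + x > 0"
    using assms by auto
  then have "((\<lambda>x. (1 - x) powr \<alpha> * (1 + x) powr \<beta>) has_real_derivative
      (\<beta> / (1 + x) - \<alpha> / (1 - x)) * ((1 - x) powr \<alpha> * (1 + x) powr \<beta>)) (at x)"
    by (auto intro!: derivative_eq_intros simp: powr_diff field_simps)
  moreover have "weight \<gamma> = (\<lambda>x. (1 - x) powr \<alpha> * (1 + x) powr \<beta>)"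
    using Jacobi by auto
  moreover have "(1 - x\<^sup>2) * (\<beta> / (1 + x) - \<alpha> / (1 - x)) = - (\<alpha> - \<beta>) - (\<alpha> + \<beta>) * x"
    using x by (simp add: divide_simps) (simp add: algebra_simps power2_eq_square)
  then have "poly (pearson2 \<gamma>) x * (\<beta> / (1 + x) - \<alpha> / (1 - x)) = poly (pearson1 \<gamma>) x"
    using Jacobi by (simp add: algebra_simps power2_eq_square)
  ultimately show ?thesis
    by (metis mult.assoc)
qed

definition moment_mat :: "classical \<Rightarrow> smat" where
  "moment_mat \<gamma> = (\<lambda>i j. LINT x:weight_interval \<gamma>|lborel. x ^ (i + j) * weight \<gamma> x)"

definition is_LU :: "smat \<Rightarrow> smat \<Rightarrow> (nat \<Rightarrow> real) \<Rightarrow> bool" where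
  "is_LU G S h \<longleftrightarrow> lower_unitriangular S \<and>
     G = smat_inv S \<odot> smat_diag h \<odot> smat_transpose (smat_inv S)"

definition S_mat :: "classical \<Rightarrow> smat" where
  "S_mat \<gamma> = (THE S. \<exists>h. is_LU (moment_mat \<gamma>) S h)"

definition H_seq :: "classical \<Rightarrow> nat \<Rightarrow> real" where
  "H_seq \<gamma> = (THE h. is_LU (moment_mat \<gamma>) (S_mat \<gamma>) h)"

definition H_mat :: "classical \<Rightarrow> smat" where
  "H_mat \<gamma> = smat_diag (H_seq \<gamma>)"

end

theory Submission
  imports Defs "HOL-Probability.Distributions" "HOL-Real_Asymp.Real_Asymp"
begin

text \<open>
  Write \<open>G\<close>, \<open>G'\<close> for the moment matrices of \<open>u\<^sub>\<gamma>\<close> and \<open>p\<^sub>2 u\<^sub>\<gamma>\<close>, \<open>D\<close> for the derivation matrix, and \<open>M\<close>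
  for the matrix of the operator \<open>f \<mapsto> p\<^sub>2' f + p\<^sub>1 f + p\<^sub>2 f'\<close> on the monomials. By the Pearson equation this
  operator is \<open>f \<mapsto> (f p\<^sub>2 u\<^sub>\<gamma>)' / u\<^sub>\<gamma>\<close>, so up to sign it is adjoint to differentiation: since
  \<open>q p\<^sub>2 u\<^sub>\<gamma>\<close> vanishes at both ends of the interval for every polynomial \<open>q\<close>, the integral of its
  derivative is zero (\<open>moment_functional_pearson\<close>), which on monomials reads \<open>D G' = - G M\<^sup>T\<close>
  (\<open>deriv_mat_moment_mat\<close>). Inserting the factorizations of \<open>G\<close> and \<open>G'\<close> and cancelling triangular
  factors turns this into the matrix identity of the theorem (\<open>is_LU_intertwining\<close>). The cancellations
  need associativity of infinite matrix products, which holds because the left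
  factors have only finitely many superdiagonals or the right factors only finitely many subdiagonals.

  The factorizations exist and are unique because a weight defines a positive definite bilinear form
  on polynomials (locale \<open>definite_functional\<close>): the rows of \<open>S\<close> are the coefficients of the monic
  orthogonal polynomials, and the diagonal entries of \<open>H\<close> are their squared norms.

  The entry formulas come from comparing the shapes of the two sides. The left side
  \<open>S D S'\<^bsup>-1\<^esup>\<close> is strictly lower triangular; \<open>M\<close> is tridiagonal with row
  \<open>j c, B + j b, A + j a\<close>, so the right side is the transpose of a matrix with at most one superdiagonal.
  Hence both sides live on the first subdiagonal only, where the left side has the entries
  \<open>1, 2, 3, \<dots>\<close>. Comparison there gives the recurrence for \<open>H\<close>. Vanishing on the main diagonal and on the
  second subdiagonal gives two linear relations between the subdiagonals of \<open>S\<close> and \<open>S'\<close>, and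
  eliminating \<open>S'\<close> leaves \<open>(A + 2 n a) S\<^bsub>n+1,n\<^esub> = (n + 1) (B + n b)\<close>.
\<close>

section \<open>Matrices with finitely many superdiagonals\<close>

text \<open>
  A bound on the number of superdiagonals makes every row finitely supported, so that the series in a
  product become finite sums, and it adds up under multiplication. Bounds on the subdiagonals are
  expressed through the transpose.
\<close>

definition upper_band :: "nat \<Rightarrow> smat \<Rightarrow> bool" where
  "upper_band p M \<longleftrightarrow> (\<forall>i j. i + p < j \<longrightarrow> M i j = 0)"

lemma smat_mult_entry:
  assumes "upper_band p M"
  shows "(M \<odot> N) i j = (\<Sum>k\<le>i + p. M i k * N k j)"
  unfolding smat_mult_def
  by (rule suminf_finite) (use assms in \<open>auto simp: upper_band_def\<close>)

lemma upper_band_mult: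
  assumes "upper_band p M" "upper_band q N"
  shows "upper_band (p + q) (M \<odot> N)"
  unfolding upper_band_def
proof (intro allI impI)
  fix i j :: nat
  assume "i + (p + q) < j"
  then show "(M \<odot> N) i j = 0"
    using assms(2) by (auto simp: smat_mult_entry[OF assms(1)] upper_band_def intro!: sum.neutral)
qed

lemma upper_band_diag: "upper_band 0 (smat_diag h)"
  by (auto simp: upper_band_def smat_diag_def)

lemma upper_band_lower_unitriangular: "lower_unitriangular M \<Longrightarrow> upper_band 0 M"
  by (auto simp: upper_band_def lower_unitriangular_def)

lemma smat_transpose_mult: "smat_transpose (M \<odot> N) = smat_transpose N \<odot> smat_transpose M"
  by (simp add: smat_transpose_def smat_mult_def mult.commute)

lemma smat_transpose_transpose [simp]: "smat_transpose (smat_transpose M) = M"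
  by (simp add: smat_transpose_def)

lemma smat_transpose_diag [simp]: "smat_transpose (smat_diag h) = smat_diag h"
  by (auto simp: smat_transpose_def smat_diag_def fun_eq_iff)

text \<open>
  For infinite matrices associativity is an exchange of summations. Here the double sum is finite
  because the rows of both left factors are; the right factor is arbitrary, which matters because moment
  matrices have full rows and columns.
\<close>

lemma smat_mult_assoc:
  assumes M: "upper_band p M" and N: "upper_band q N"
  shows "(M \<odot> N) \<odot> K = M \<odot> (N \<odot> K)"
proof (intro ext)
  fix i j
  have N': "(\<Sum>l\<le>k + q. N k l * K l j) = (\<Sum>l\<le>i + p + q. N k l * K l j)" if "k \<le> i + p" for k
    using that N by (intro sum.mono_neutral_left) (auto simp: upper_band_def)
  have "((M \<odot> N) \<odot> K) i j = (\<Sum>l\<le>i + p + q. \<Sum>k\<le>i + p. M i k * N k l * K l j)"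
    by (simp add: smat_mult_entry[OF upper_band_mult[OF M N]] smat_mult_entry[OF M]
        sum_distrib_right add.assoc)
  also have "\<dots> = (\<Sum>k\<le>i + p. \<Sum>l\<le>i + p + q. M i k * N k l * K l j)"
    by (rule sum.swap)
  also have "\<dots> = (M \<odot> (N \<odot> K)) i j"
    by (simp add: smat_mult_entry[OF M] smat_mult_entry[OF N] N' sum_distrib_left mult.assoc)
  finally show "((M \<odot> N) \<odot> K) i j = (M \<odot> (N \<odot> K)) i j" .
qed

lemma smat_mult_assoc_transpose:
  assumes "upper_band p (smat_transpose N)" "upper_band q (smat_transpose K)"
  shows "(M \<odot> N) \<odot> K = M \<odot> (N \<odot> K)"
proof -
  have "smat_transpose ((M \<odot> N) \<odot> K) = smat_transpose (M \<odot> (N \<odot> K))"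
    by (simp add: smat_transpose_mult smat_mult_assoc[OF assms(2,1)])
  then show ?thesis
    by (metis smat_transpose_transpose)
qed

lemma smat_diag_mult: "(smat_diag h \<odot> M) i j = h i * M i j"
  by (subst smat_mult_entry[OF upper_band_diag]) (simp add: smat_diag_def if_distrib[of "\<lambda>x. x * _"] cong: if_cong)

lemma smat_mult_diag: "(M \<odot> smat_diag h) i j = M i j * h j"
proof -
  have "(M \<odot> smat_diag h) i j = (smat_diag h \<odot> smat_transpose M) j i"
    by (metis smat_transpose_mult smat_transpose_diag smat_transpose_def)
  then show ?thesis
    by (simp add: smat_diag_mult smat_transpose_def)
qed

lemma smat_id_mult [simp]: "smat_id \<odot> M = M"
  by (simp add: fun_eq_iff smat_id_def smat_diag_mult)

lemma smat_mult_id [simp]: "M \<odot> smat_id = M"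
  by (simp add: fun_eq_iff smat_id_def smat_mult_diag)

lemma smat_mult_minus_left: "(- M) \<odot> N = - (M \<odot> N)" if "upper_band p M"
proof -
  have "upper_band p (- M)" using that by (auto simp: upper_band_def)
  then show ?thesis
    using that by (auto simp: fun_eq_iff smat_mult_entry sum_negf)
qed

function forward_subst :: "smat \<Rightarrow> smat" where
  "forward_subst M i j = (if i = j then 1 else 0) - (\<Sum>k<i. M i k * forward_subst M k j)"
  by auto
termination
  by (relation "inv_image less_than (\<lambda>(M, i, j). i)") auto

declare forward_subst.simps [simp del]

lemma smat_mult_lower_unitriangular_entry:
  assumes "lower_unitriangular M"
  shows "(M \<odot> N) i j = N i j + (\<Sum>k<i. M i k * N k j)"
  using assms
  by (simp add: smat_mult_entry[OF upper_band_lower_unitriangular] lower_unitriangular_def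
      lessThan_Suc_atMost[symmetric])

lemma smat_mult_forward_subst:
  assumes "lower_unitriangular M"
  shows "M \<odot> forward_subst M = smat_id"
proof (intro ext)
  fix i j
  show "(M \<odot> forward_subst M) i j = smat_id i j"
    using forward_subst.simps[of M i j]
    by (simp add: smat_mult_lower_unitriangular_entry[OF assms] smat_id_def smat_diag_def)
qed

lemma lower_unitriangular_forward_subst: "lower_unitriangular (forward_subst M)"
proof -
  have *: "(i < j \<longrightarrow> forward_subst M i j = 0) \<and> forward_subst M i i = 1" for i j
  proof (induction i arbitrary: j rule: less_induct)
    case (less i)
    have "(\<Sum>k<i. M i k * forward_subst M k j) = 0" if "i \<le> j" for j
      using less[of _ j] that by (intro sum.neutral) auto
    then show ?case
      by (simp add: forward_subst.simps[of M i])
  qed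
  show ?thesis
    using * by (auto simp: lower_unitriangular_def)
qed

text \<open>
  Forward substitution yields a right inverse that is again lower unitriangular, hence itself has a
  right inverse; by associativity that one is the original matrix, so the inverse is two-sided.
\<close>

lemma smat_inv_lower_unitriangular:
  assumes M: "lower_unitriangular M"
  shows "lower_unitriangular (smat_inv M)" "M \<odot> smat_inv M = smat_id" "smat_inv M \<odot> M = smat_id"
proof -
  note [intro] = upper_band_lower_unitriangular
  define N where "N = forward_subst M"
  have N: "lower_unitriangular N" and MN: "M \<odot> N = smat_id"
    by (simp_all add: N_def lower_unitriangular_forward_subst smat_mult_forward_subst M)
  define K where "K = forward_subst N"
  have NK: "N \<odot> K = smat_id"
    by (simp add: K_def smat_mult_forward_subst N)
  \<comment> \<open>The right inverse of the right inverse is the matrix itself.\<close>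
  have "M = M \<odot> (N \<odot> K)"
    by (simp add: NK)
  also have "\<dots> = K"
    using M N by (subst smat_mult_assoc[symmetric, of 0 _ 0]) (auto simp: MN)
  finally have NM: "N \<odot> M = smat_id"
    using NK by simp
  have "smat_inv M = N"
    unfolding smat_inv_def
  proof (rule the_equality)
    fix N' assume N': "M \<odot> N' = smat_id \<and> N' \<odot> M = smat_id"
    have "N' = (N \<odot> M) \<odot> N'"
      by (simp add: NM)
    also have "\<dots> = N"
      using M N N' by (subst smat_mult_assoc[of 0 _ 0]) auto
    finally show "N' = N" .
  qed (use MN NM in auto)
  then show "lower_unitriangular (smat_inv M)" "M \<odot> smat_inv M = smat_id"
    "smat_inv M \<odot> M = smat_id"
    using N MN NM by auto
qed

lemma smat_inv_diag:
  assumes "\<And>i. h i \<noteq> 0"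
  shows "smat_inv (smat_diag h) = smat_diag (\<lambda>i. 1 / h i)"
  unfolding smat_inv_def
proof (rule the_equality)
  fix N assume N: "smat_diag h \<odot> N = smat_id \<and> N \<odot> smat_diag h = smat_id"
  then have "h i * N i j = smat_id i j" for i j
    by (metis smat_diag_mult)
  then have "N i j = smat_id i j / h i" for i j
    using assms by (metis nonzero_mult_div_cancel_left)
  then show "N = smat_diag (\<lambda>i. 1 / h i)"
    by (auto simp: fun_eq_iff smat_id_def smat_diag_def)
next
  have "(smat_diag h \<odot> smat_diag (\<lambda>i. 1 / h i)) i j = smat_id i j"
    "(smat_diag (\<lambda>i. 1 / h i) \<odot> smat_diag h) i j = smat_id i j" for i j
    unfolding smat_diag_mult using assms by (auto simp: smat_id_def smat_diag_def)
  then show "smat_diag h \<odot> smat_diag (\<lambda>i. 1 / h i) = smat_id \<and>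
      smat_diag (\<lambda>i. 1 / h i) \<odot> smat_diag h = smat_id"
    by blast
qed

lemma sum_atMost_last:
  fixes f :: "nat \<Rightarrow> real"
  assumes "\<And>k. k < n \<Longrightarrow> f k = 0"
  shows "(\<Sum>k\<le>n. f k) = f n" "(\<Sum>k\<le>Suc n. f k) = f n + f (Suc n)"
proof -
  show "(\<Sum>k\<le>n. f k) = f n"
    using assms by (cases n) (auto intro!: sum.neutral)
  then show "(\<Sum>k\<le>Suc n. f k) = f n + f (Suc n)"
    by simp
qed

lemma smat_inv_subdiagonal:
  assumes "lower_unitriangular M"
  shows "smat_inv M (Suc n) n = - M (Suc n) n"
proof -
  note inv = smat_inv_lower_unitriangular[OF assms]
  have "0 = (M \<odot> smat_inv M) (Suc n) n"
    by (simp add: inv(2) smat_id_def smat_diag_def)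
  also have "\<dots> = smat_inv M (Suc n) n + (\<Sum>k\<le>n. M (Suc n) k * smat_inv M k n)"
    by (simp add: smat_mult_lower_unitriangular_entry[OF assms] lessThan_Suc_atMost)
  also have "(\<Sum>k\<le>n. M (Suc n) k * smat_inv M k n) = M (Suc n) n"
    using inv(1) by (subst sum_atMost_last) (auto simp: lower_unitriangular_def)
  finally show ?thesis
    by simp
qed

section \<open>Triangular factorizations\<close>

lemma is_LU_mult_left:
  assumes "is_LU G S h"
  shows "S \<odot> G = smat_diag h \<odot> smat_transpose (smat_inv S)"
proof -
  let ?T = "smat_inv S" and ?H = "smat_diag h"
  have S: "lower_unitriangular S" and G: "G = ?T \<odot> ?H \<odot> smat_transpose ?T"
    using assms by (auto simp: is_LU_def)
  note inv = smat_inv_lower_unitriangular[OF S]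
  have bands: "upper_band 0 S" "upper_band 0 ?T" "upper_band 0 ?H"
    using S inv(1) upper_band_diag by (auto intro: upper_band_lower_unitriangular)
  have "S \<odot> G = (S \<odot> ?T) \<odot> (?H \<odot> smat_transpose ?T)"
    by (simp add: G smat_mult_assoc[OF bands(2,3)] smat_mult_assoc[OF bands(1,2)])
  then show ?thesis
    by (simp add: inv(2))
qed

lemma is_LU_mult_left_entry:
  assumes "is_LU G S h" "j \<le> i"
  shows "(S \<odot> G) i j = (if j = i then h i else 0)"
proof -
  have "lower_unitriangular (smat_inv S)"
    using assms by (auto simp: is_LU_def intro: smat_inv_lower_unitriangular)
  then show ?thesis
    using assms(2) unfolding is_LU_mult_left[OF assms(1)] smat_diag_mult
    by (auto simp: smat_transpose_def lower_unitriangular_def)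
qed

text \<open>
  If \<open>D G' = - G M\<^sup>T\<close>, then \<open>S D S'\<^bsup>-1\<^esup> H' S'\<^bsup>-T\<^esup> = S D G' = - S G M\<^sup>T = - H S\<^bsup>-T\<^esup> M\<^sup>T\<close>, and multiplication by
  \<open>S'\<^sup>T\<close> and \<open>H'\<^bsup>-1\<^esup>\<close> from the right isolates \<open>S D S'\<^bsup>-1\<^esup>\<close>. Re-bracketing uses row-finiteness when triangular
  factors are cancelled on the left, and column-finiteness when they are cancelled on the right.
\<close>

lemma is_LU_intertwining:
  assumes LU: "is_LU G S h" and LU': "is_LU G' S' h'" and h': "\<And>i. h' i \<noteq> 0"
    and D: "upper_band p D" and M: "upper_band q M"
    and DG: "D \<odot> G' = - (G \<odot> smat_transpose M)"
  shows "S \<odot> D \<odot> smat_inv S' =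
    - smat_diag h \<odot> smat_transpose (S' \<odot> M \<odot> smat_inv S) \<odot> smat_inv (smat_diag h')"
proof -
  let ?T = "smat_inv S" and ?T' = "smat_inv S'" and ?H = "smat_diag h" and ?H' = "smat_diag h'"
  note tr = smat_transpose_mult
  have S: "lower_unitriangular S" and S': "lower_unitriangular S'"
    and G': "G' = ?T' \<odot> ?H' \<odot> smat_transpose ?T'"
    using LU LU' by (auto simp: is_LU_def)
  note inv = smat_inv_lower_unitriangular[OF S] and inv' = smat_inv_lower_unitriangular[OF S']
  note bands [simp] = upper_band_diag upper_band_lower_unitriangular[OF S] upper_band_lower_unitriangular[OF S']
    upper_band_lower_unitriangular[OF inv(1)] upper_band_lower_unitriangular[OF inv'(1)] D M
  have bSD: "upper_band p (S \<odot> D)"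
    using upper_band_mult[of 0 S p D] by simp
  have bSDT: "upper_band p (S \<odot> D \<odot> ?T')"
    using upper_band_mult[OF bSD, of 0 ?T'] by simp
  have inv_tr: "smat_transpose ?T' \<odot> smat_transpose S' = smat_id"
    by (simp add: tr[symmetric] inv' smat_id_def)
  have SGM: "S \<odot> (G \<odot> smat_transpose M) = ?H \<odot> smat_transpose (M \<odot> ?T)"
  proof -
    have G: "G = ?T \<odot> (?H \<odot> smat_transpose ?T)"
      using LU by (auto simp: is_LU_def smat_mult_assoc[of 0 ?T 0 ?H])
    have b: "upper_band 0 (smat_transpose (?H \<odot> smat_transpose ?T))"
      using upper_band_mult[of 0 ?T 0 ?H] by (simp add: tr)
    have "G \<odot> smat_transpose M = ?T \<odot> (?H \<odot> smat_transpose ?T \<odot> smat_transpose M)"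
      unfolding G by (rule smat_mult_assoc_transpose[OF b, of q]) simp
    then have "S \<odot> (G \<odot> smat_transpose M) = (S \<odot> ?T) \<odot> (?H \<odot> smat_transpose ?T \<odot> smat_transpose M)"
      by (simp add: smat_mult_assoc[of 0 S 0 ?T])
    also have "\<dots> = ?H \<odot> (smat_transpose ?T \<odot> smat_transpose M)"
      unfolding inv(2) smat_id_mult by (rule smat_mult_assoc_transpose[of 0 _ q]) simp_all
    finally show ?thesis
      by (simp only: tr)
  qed
  have "(S \<odot> D \<odot> ?T' \<odot> ?H') \<odot> smat_transpose ?T' = (S \<odot> D) \<odot> (?T' \<odot> (?H' \<odot> smat_transpose ?T'))"
    by (subst smat_mult_assoc[OF bSDT, of 0], simp, subst smat_mult_assoc[OF bSD, of 0]) simp_all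
  also have "\<dots> = S \<odot> (D \<odot> G')"
    unfolding G' by (subst smat_mult_assoc[of 0 S p D], simp, simp, subst smat_mult_assoc[of 0 ?T' 0]) simp_all
  also have "\<dots> = - (S \<odot> (G \<odot> smat_transpose M))"
    unfolding DG by (auto simp: fun_eq_iff smat_mult_entry[of 0 S] sum_negf)
  also have "\<dots> = (- ?H) \<odot> smat_transpose (M \<odot> ?T)"
    unfolding SGM by (rule smat_mult_minus_left[OF upper_band_diag, symmetric])
  finally have *: "(S \<odot> D \<odot> ?T' \<odot> ?H') \<odot> smat_transpose ?T' = (- ?H) \<odot> smat_transpose (M \<odot> ?T)" .
  have bMT: "upper_band q (M \<odot> ?T)"
    using upper_band_mult[of q M 0 ?T] by simp
  have "S \<odot> D \<odot> ?T' \<odot> ?H' = (S \<odot> D \<odot> ?T' \<odot> ?H') \<odot> smat_transpose ?T' \<odot> smat_transpose S'"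
    by (subst smat_mult_assoc_transpose[of 0 _ 0]) (simp_all add: inv_tr)
  also have "\<dots> = (- ?H) \<odot> (smat_transpose (M \<odot> ?T) \<odot> smat_transpose S')"
    unfolding * by (rule smat_mult_assoc_transpose[of q _ 0]) (simp_all add: bMT)
  also have "smat_transpose (M \<odot> ?T) \<odot> smat_transpose S' = smat_transpose (S' \<odot> M \<odot> ?T)"
    by (simp add: tr[symmetric] smat_mult_assoc[of 0 S' q M])
  finally have **: "S \<odot> D \<odot> ?T' \<odot> ?H' = - ?H \<odot> smat_transpose (S' \<odot> M \<odot> ?T)" .
  show ?thesis
    unfolding **[symmetric] smat_inv_diag[OF h']
    using h' by (auto simp: fun_eq_iff smat_mult_diag)
qed

section \<open>Gram matrices of definite moment functionals\<close>

definition row_poly :: "smat \<Rightarrow> nat \<Rightarrow> real poly" where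
  "row_poly S i = (\<Sum>k\<le>i. monom (S i k) k)"

lemma coeff_row_poly: "coeff (row_poly S i) k = (if k \<le> i then S i k else 0)"
  by (simp add: row_poly_def coeff_sum)

text \<open>
  Integration against a weight, reduced to the properties that give its Gram matrix a unique triangular
  factorization: \<open>(p, q) \<mapsto> L (p * q)\<close> is a symmetric positive definite bilinear form.
\<close>

locale definite_functional =
  fixes L :: "real poly \<Rightarrow> real"
  assumes add: "L (p + q) = L p + L q"
    and smult: "L (smult c p) = c * L p"
    and pos: "p \<noteq> 0 \<Longrightarrow> L (p * p) > 0"
begin

definition gram :: smat where
  "gram i j = L (monom 1 (i + j))"

lemma zero: "L 0 = 0"
  using smult[of 0 0] by simp

lemma diff: "L (p - q) = L p - L q"
  using add[of "p - q" q] by simp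

lemma sum: "L (\<Sum>k\<in>I. f k) = (\<Sum>k\<in>I. L (f k))"
  by (induction I rule: infinite_finite_induct) (simp_all add: zero add)

lemma L_mult_expand:
  assumes "\<And>k. k \<ge> n \<Longrightarrow> coeff p k = 0"
  shows "L (p * q) = (\<Sum>k<n. coeff p k * L (q * monom 1 k))"
proof -
  have "p = (\<Sum>k<n. smult (coeff p k) (monom 1 k))"
    by (rule poly_eqI) (use assms in \<open>auto simp: coeff_sum not_less if_distrib cong: if_cong\<close>)
  then have "L (p * q) = L (\<Sum>k<n. smult (coeff p k) (q * monom 1 k))"
    by (metis (no_types, lifting) mult.commute mult_smult_left sum.cong sum_distrib_right)
  then show ?thesis
    by (simp add: sum smult)
qed

text \<open>
  Orthogonal projection onto the polynomials of degree below \<open>n\<close>, built by Gram-Schmidt: the residual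
  of \<open>x\<^sup>n\<close> under the projection for \<open>n\<close> is the new direction \<open>e\<close> that extends it to \<open>n + 1\<close>. A degree
  bound in terms of coefficients describes the zero space for \<open>n = 0\<close>, which \<open>degree\<close> cannot.
\<close>

lemma projection:
  "\<exists>s. (\<forall>k\<ge>n. coeff s k = 0) \<and> (\<forall>q. (\<forall>k\<ge>n. coeff q k = 0) \<longrightarrow> L ((r - s) * q) = 0)"
proof (induction n arbitrary: r)
  case 0
  have "L ((r - 0) * q) = 0" if "\<forall>k\<ge>0. coeff q k = 0" for q
  proof -
    have "q = 0"
      using that by (auto intro: poly_eqI)
    then show ?thesis
      by (simp add: zero)
  qed
  then show ?case
    by (intro exI[of _ 0]) auto
next
  case (Suc n)
  obtain s0 where s0: "\<forall>k\<ge>n. coeff s0 k = 0"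
    "\<And>q. \<forall>k\<ge>n. coeff q k = 0 \<Longrightarrow> L ((monom 1 n - s0) * q) = 0"
    using Suc[of "monom 1 n"] by blast
  obtain s where s: "\<forall>k\<ge>n. coeff s k = 0"
    "\<And>q. \<forall>k\<ge>n. coeff q k = 0 \<Longrightarrow> L ((r - s) * q) = 0"
    using Suc[of r] by blast
  define e where "e = monom 1 n - s0"
  have e: "coeff e k = 0" if "k > n" for k
    using s0(1) that by (auto simp: e_def)
  have e_n: "coeff e n = 1"
    using s0(1) by (simp add: e_def)
  then have "L (e * e) > 0"
    by (intro pos) auto
  define t where "t = L ((r - s) * e) / L (e * e)"
  have "L ((r - (s + smult t e)) * q) = 0" if q: "\<forall>k\<ge>Suc n. coeff q k = 0" for q
  proof -
    \<comment> \<open>Since e is monic of degree n, this removes the leading term of q.\<close>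
    define q0 where "q0 = q - smult (coeff q n) e"
    have q0: "\<forall>k\<ge>n. coeff q0 k = 0"
      using q e e_n by (auto simp: q0_def Suc_le_eq dest: le_neq_implies_less)
    have "(r - (s + smult t e)) * q =
        (r - s) * q0 - smult t (e * q0) + smult (coeff q n) ((r - s) * e - smult t (e * e))"
      by (simp add: q0_def algebra_simps smult_diff_right smult_add_right)
    then have "L ((r - (s + smult t e)) * q) =
        L ((r - s) * q0) - t * L (e * q0) + coeff q n * (L ((r - s) * e) - t * L (e * e))"
      by (simp only: add diff smult)
    also have "\<dots> = 0"
      using s(2)[OF q0] s0(2)[OF q0] \<open>L (e * e) > 0\<close> by (simp add: e_def[symmetric] t_def)
    finally show ?thesis .
  qed
  moreover have "\<forall>k\<ge>Suc n. coeff (s + smult t e) k = 0"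
    using s(1) e by auto
  ultimately show ?case
    by blast
qed

lemma smat_mult_gram:
  assumes "lower_unitriangular S"
  shows "(S \<odot> gram) i j = L (row_poly S i * monom 1 j)"
proof -
  have "L (row_poly S i * monom 1 j) = (\<Sum>k<Suc i. S i k * L (monom 1 j * monom 1 k))"
    by (subst L_mult_expand[of "Suc i"]) (auto simp: coeff_row_poly)
  then show ?thesis
    using assms by (simp add: smat_mult_entry[OF upper_band_lower_unitriangular] gram_def
        mult_monom lessThan_Suc_atMost add.commute)
qed

text \<open>
  The diagonal entry \<open>h i\<close> is the squared norm of the \<open>i\<close>-th orthogonal polynomial.
\<close>

lemma is_LU_pos:
  assumes LU: "is_LU gram S h"
  shows "h i > 0"
proof -
  have S: "lower_unitriangular S"
    using LU by (auto simp: is_LU_def)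
  have "row_poly S i \<noteq> 0"
    using S coeff_row_poly[of S i i] by (auto simp: lower_unitriangular_def)
  then have "0 < L (row_poly S i * row_poly S i)"
    by (rule pos)
  also have "\<dots> = (\<Sum>k<Suc i. S i k * (S \<odot> gram) i k)"
    by (subst L_mult_expand[of "Suc i"]) (auto simp: coeff_row_poly smat_mult_gram[OF S])
  also have "\<dots> = h i"
    using S by (simp add: is_LU_mult_left_entry[OF LU] lower_unitriangular_def)
  finally show ?thesis .
qed

text \<open>
  By \<open>S \<odot> G = H \<odot> (S\<^bsup>-1\<^esup>)\<^sup>T\<close>, row \<open>i\<close> of \<open>S\<close> is a monic polynomial of degree \<open>i\<close> orthogonal to all lower powers.
  The difference of two such rows has degree below \<open>i\<close>, so it is orthogonal to itself and vanishes.
\<close>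

lemma is_LU_unique:
  assumes LU: "is_LU gram S h" and LU': "is_LU gram S' h'"
  shows "S = S'" "h = h'"
proof -
  have S: "lower_unitriangular S" and S': "lower_unitriangular S'"
    using LU LU' by (auto simp: is_LU_def)
  have "S i = S' i" for i
  proof -
    define d where "d = row_poly S i - row_poly S' i"
    have d: "coeff d k = 0" if "k \<ge> i" for k
      using that S S' by (auto simp: d_def coeff_row_poly lower_unitriangular_def)
    have "L (d * monom 1 k) = 0" if "k < i" for k
      using that is_LU_mult_left_entry[OF LU, of k i] is_LU_mult_left_entry[OF LU', of k i]
      by (simp add: d_def left_diff_distrib diff smat_mult_gram S S')
    then have "L (d * d) = 0"
      by (subst L_mult_expand[OF d]) auto
    then have "row_poly S i = row_poly S' i"
      using pos[of d] by (auto simp: d_def)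
    then have "S i k = S' i k" if "k \<le> i" for k
      using that by (metis coeff_row_poly)
    then show "S i = S' i"
      using S S' by (auto simp: fun_eq_iff lower_unitriangular_def) (metis not_le)
  qed
  then show "S = S'"
    by auto
  then have "h i = h' i" for i
    using is_LU_mult_left_entry[OF LU, of i i] is_LU_mult_left_entry[OF LU', of i i] by simp
  then show "h = h'"
    by (simp add: fun_eq_iff)
qed

text \<open>
  The residuals of the powers of \<open>x\<close> under the projections are monic orthogonal polynomials; their
  coefficients form a matrix \<open>S\<close> for which \<open>S \<odot> G \<odot> S\<^sup>T\<close> is diagonal.
\<close>

lemma is_LU_exists: "\<exists>S h. is_LU gram S h"
proof -
  obtain s where s: "\<And>n k. k \<ge> n \<Longrightarrow> coeff (s n) k = 0"
    "\<And>n q. \<forall>k\<ge>n. coeff q k = 0 \<Longrightarrow> L ((monom 1 n - s n) * q) = 0"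
    using projection[of n "monom 1 n" for n] by metis
  define S :: smat where "S = (\<lambda>n k. coeff (monom 1 n - s n) k)"
  have S: "lower_unitriangular S"
    using s(1) by (auto simp: S_def lower_unitriangular_def)
  have row: "row_poly S n = monom 1 n - s n" for n
    by (rule poly_eqI) (use s(1)[of n] in \<open>auto simp: coeff_row_poly S_def\<close>)
  have orth: "L (row_poly S i * row_poly S j) = 0" if "j < i" for i j
    unfolding row[of i] by (rule s(2)) (use that in \<open>auto simp: coeff_row_poly\<close>)
  define h where "h = (\<lambda>i. L (row_poly S i * row_poly S i))"
  have SGS: "S \<odot> (gram \<odot> smat_transpose S) = smat_diag h"
  proof (intro ext)
    fix i j
    have "smat_transpose gram = gram"
      by (simp add: smat_transpose_def gram_def fun_eq_iff add.commute)
    then have "gram \<odot> smat_transpose S = smat_transpose (S \<odot> gram)"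
      by (simp only: smat_transpose_mult)
    then have *: "(gram \<odot> smat_transpose S) k j = L (row_poly S j * monom 1 k)" for k
      by (simp add: smat_mult_gram[OF S] smat_transpose_def)
    have "(S \<odot> (gram \<odot> smat_transpose S)) i j = L (row_poly S i * row_poly S j)"
      using S by (subst L_mult_expand[of "Suc i"])
        (auto simp: coeff_row_poly smat_mult_entry[OF upper_band_lower_unitriangular] *
          lessThan_Suc_atMost)
    then show "(S \<odot> (gram \<odot> smat_transpose S)) i j = smat_diag h i j"
      using orth[of i j] orth[of j i]
      by (cases i j rule: linorder_cases) (auto simp: smat_diag_def h_def mult.commute)
  qed
  let ?T = "smat_inv S"
  note inv = smat_inv_lower_unitriangular[OF S]
  note bands [simp] = upper_band_lower_unitriangular[OF S] upper_band_lower_unitriangular[OF inv(1)]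
  have inv_tr: "smat_transpose S \<odot> smat_transpose ?T = smat_id"
    by (simp add: smat_transpose_mult[symmetric] inv(3) smat_id_def)
  have "?T \<odot> smat_diag h = gram \<odot> smat_transpose S"
    unfolding SGS[symmetric] by (subst smat_mult_assoc[symmetric, of 0 _ 0]) (simp_all add: inv(3))
  then have "?T \<odot> smat_diag h \<odot> smat_transpose ?T = gram"
    by (simp add: smat_mult_assoc_transpose[of 0 _ 0] inv_tr)
  then have "is_LU gram S h"
    using S by (simp add: is_LU_def)
  then show ?thesis
    by blast
qed

end

section \<open>The moment functional of a classical weight\<close>

definition moment_functional :: "classical \<Rightarrow> real poly \<Rightarrow> real" where
  "moment_functional \<gamma> p = (LINT x:weight_interval \<gamma>|lborel. poly p x * weight \<gamma> x)"

lemma weight_pos: "x \<in> weight_interval \<gamma> \<Longrightarrow> weight \<gamma> x > 0"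
  by (cases \<gamma>) auto

lemma weight_interval_borel [measurable]: "weight_interval \<gamma> \<in> sets borel"
  by (cases \<gamma>) auto

lemma weight_borel [measurable]: "weight \<gamma> \<in> borel_measurable borel"
proof (cases \<gamma>)
  case Hermite
  then have "weight \<gamma> = (\<lambda>x. exp (- (x ^ 2)))" by auto
  then show ?thesis by simp
next
  case (Laguerre \<alpha>)
  then have "weight \<gamma> = (\<lambda>x. x powr \<alpha> * exp (- x))" by auto
  then show ?thesis by simp
next
  case (Jacobi \<alpha> \<beta>)
  then have "weight \<gamma> = (\<lambda>x. (1 - x) powr \<alpha> * (1 + x) powr \<beta>)" by auto
  then show ?thesis by simp
qed

lemma poly_borel [measurable]: "poly p \<in> borel_measurable (borel :: real measure)"
  by (intro borel_measurable_continuous_onI continuous_intros)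

lemma set_integrable_lborel_nonneg:
  fixes f :: "real \<Rightarrow> real"
  assumes "f integrable_on A" "A \<in> sets borel" "f \<in> borel_measurable borel" "\<And>x. x \<in> A \<Longrightarrow> f x \<ge> 0"
  shows "set_integrable lborel A f"
proof -
  have "f absolutely_integrable_on A"
    using assms by (intro nonnegative_absolutely_integrable_1) auto
  then show ?thesis
    using assms(2,3) by (simp add: set_integrable_def integrable_completion)
qed

text \<open>
  The moments are values of the Gamma integral.
\<close>

lemma Laguerre_moment_integrable:
  assumes "\<alpha> > -1"
  shows "set_integrable lborel {0<..} (\<lambda>x::real. x ^ n * (x powr \<alpha> * exp (- x)))"
proof (rule set_integrable_lborel_nonneg)
  have "(\<lambda>t. t powr (\<alpha> + n + 1 - 1) / exp t) integrable_on {0..}"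
    using Gamma_integral_real[of "\<alpha> + n + 1"] assms by (intro has_integral_integrable) auto
  then have "(\<lambda>t. t powr (\<alpha> + n) / exp t) integrable_on {0..}"
    by simp
  then have "(\<lambda>t. t powr (\<alpha> + n) / exp t) integrable_on {0<..}"
    by (rule integrable_spike_set) (auto intro: negligible_subset[of "{0}"])
  then show "(\<lambda>x::real. x ^ n * (x powr \<alpha> * exp (- x))) integrable_on {0<..}"
    by (rule integrable_eq) (auto simp: powr_add powr_realpow exp_minus field_simps)
qed auto

text \<open>
  The substitution \<open>t = (1 + x) / 2\<close> turns the weight into a multiple of the integrand of the Beta function.
\<close>

lemma Jacobi_weight_integrable:
  assumes "\<alpha> > -1" "\<beta> > -1"
  shows "set_integrable lborel {-1<..<1} (\<lambda>x::real. (1 - x) powr \<alpha> * (1 + x) powr \<beta>)"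
proof -
  let ?f = "\<lambda>t. indicator {0..1} t *\<^sub>R (t powr \<beta> * (1 - t) powr \<alpha>)"
  have "integrable lborel ?f"
    using integrable_Beta[of "\<beta> + 1" "\<alpha> + 1"] assms by (simp add: set_integrable_def)
  then have "integrable lborel (\<lambda>x. 2 powr (\<alpha> + \<beta>) * ?f (1 / 2 + (1 / 2) * x))"
    by (intro integrable_mult_right lborel_integrable_real_affine) auto
  moreover have "(\<lambda>x. 2 powr (\<alpha> + \<beta>) * ?f (1 / 2 + (1 / 2) * x)) =
      (\<lambda>x. indicator {-1..1} x *\<^sub>R ((1 - x) powr \<alpha> * (1 + x) powr \<beta>))"
  proof
    fix x :: real
    have "(1 - x) powr \<alpha> = 2 powr \<alpha> * (1 - (1 / 2 + (1 / 2) * x)) powr \<alpha>"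
      "(1 + x) powr \<beta> = 2 powr \<beta> * (1 / 2 + (1 / 2) * x) powr \<beta>" if "x \<in> {-1..1}"
      using that by (auto simp: powr_mult[symmetric] algebra_simps)
    then show "2 powr (\<alpha> + \<beta>) * ?f (1 / 2 + (1 / 2) * x) =
        indicator {-1..1} x *\<^sub>R ((1 - x) powr \<alpha> * (1 + x) powr \<beta>)"
      by (auto simp: indicator_def powr_add)
  qed
  ultimately have "set_integrable lborel {-1..1} (\<lambda>x. (1 - x) powr \<alpha> * (1 + x) powr \<beta>)"
    unfolding set_integrable_def by (simp only:)
  then show ?thesis
    by (rule set_integrable_subset) auto
qed

lemma moment_integrable:
  assumes "admissible \<gamma>"
  shows "set_integrable lborel (weight_interval \<gamma>) (\<lambda>x. x ^ n * weight \<gamma> x)"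
proof (cases \<gamma>)
  case Hermite
  \<comment> \<open>Up to a factor, the Hermite weight is the density of a centred normal law of variance 1/2.\<close>
  have "normal_density 0 (1 / sqrt 2) x = 1 / sqrt pi * exp (- (x ^ 2))" for x
    by (simp add: normal_density_def power_divide)
  then have "integrable lborel (\<lambda>x. 1 / sqrt pi * exp (- (x ^ 2)) * x ^ n)"
    using integrable_normal_moment[of "1 / sqrt 2" 0 n] by simp
  then have "integrable lborel (\<lambda>x. sqrt pi * (1 / sqrt pi * exp (- (x ^ 2)) * x ^ n))"
    by (rule integrable_mult_right)
  then show ?thesis
    using Hermite by (simp add: set_integrable_def mult.commute)
next
  case (Laguerre \<alpha>)
  then show ?thesis
    using Laguerre_moment_integrable assms by simp
next
  case (Jacobi \<alpha> \<beta>)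
  have "set_integrable lborel {-1<..<1} (\<lambda>x::real. x ^ n * ((1 - x) powr \<alpha> * (1 + x) powr \<beta>))"
  proof (rule set_integrable_bound[OF Jacobi_weight_integrable[of \<alpha> \<beta>]])
    show "set_borel_measurable lborel {- 1<..<1} (\<lambda>x::real. x ^ n * ((1 - x) powr \<alpha> * (1 + x) powr \<beta>))"
      by (simp add: set_borel_measurable_def)
    have "\<bar>x\<bar> ^ n * w \<le> w" if "x \<in> {-1<..<1}" "w \<ge> 0" for x w :: real
      using that by (intro mult_left_le_one_le power_le_one) auto
    then show "AE x in lborel. x \<in> {- 1<..<1} \<longrightarrow>
        norm (x ^ n * ((1 - x) powr \<alpha> * (1 + x) powr \<beta>)) \<le> norm ((1 - x) powr \<alpha> * (1 + x) powr \<beta>)"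
      by (auto simp: abs_mult power_abs)
  qed (use assms Jacobi in auto)
  then show ?thesis
    using Jacobi by simp
qed

lemma poly_weight_integrable:
  assumes "admissible \<gamma>"
  shows "set_integrable lborel (weight_interval \<gamma>) (\<lambda>x. poly p x * weight \<gamma> x)"
proof -
  have "integrable lborel (\<lambda>x. \<Sum>k\<le>degree p.
      coeff p k *\<^sub>R (indicator (weight_interval \<gamma>) x *\<^sub>R (x ^ k * weight \<gamma> x)))"
    using moment_integrable[OF assms]
    by (intro Bochner_Integration.integrable_sum integrable_scaleR_right) (simp add: set_integrable_def)
  moreover have "indicator (weight_interval \<gamma>) x *\<^sub>R (poly p x * weight \<gamma> x) =
      (\<Sum>k\<le>degree p. coeff p k *\<^sub>R (indicator (weight_interval \<gamma>) x *\<^sub>R (x ^ k * weight \<gamma> x)))" for x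
    by (cases "x \<in> weight_interval \<gamma>") (simp_all add: poly_altdef sum_distrib_right mult.assoc)
  ultimately show ?thesis
    by (simp only: set_integrable_def)
qed

text \<open>
  Definiteness: a nonzero polynomial has finitely many zeros and the weight is positive, so \<open>p\<^sup>2 u\<close>
  vanishes almost nowhere on an interval of positive length.
\<close>

lemma definite_functional_moment_functional:
  assumes "admissible \<gamma>"
  shows "definite_functional (moment_functional \<gamma>)"
proof
  note int = poly_weight_integrable[OF assms]
  fix p q :: "real poly" and c :: real
  show "moment_functional \<gamma> (p + q) = moment_functional \<gamma> p + moment_functional \<gamma> q"
    unfolding moment_functional_def set_integral_add(2)[OF int int, symmetric]
    by (simp add: distrib_right)
  show "moment_functional \<gamma> (smult c p) = c * moment_functional \<gamma> p"
    by (simp add: moment_functional_def mult.assoc)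
  show "moment_functional \<gamma> (p * p) > 0" if "p \<noteq> 0"
  proof -
    let ?I = "weight_interval \<gamma>"
    let ?f = "\<lambda>x. indicator ?I x *\<^sub>R (poly (p * p) x * weight \<gamma> x)"
    have nonneg: "?f x \<ge> 0" for x
      using weight_pos[of x \<gamma>] by (auto simp: indicator_def)
    have "moment_functional \<gamma> (p * p) \<noteq> 0"
    proof
      assume "moment_functional \<gamma> (p * p) = 0"
      then have "AE x in lborel. ?f x = 0"
        using integral_nonneg_eq_0_iff_AE[of lborel ?f] int[of "p * p"] nonneg
        unfolding moment_functional_def set_lebesgue_integral_def set_integrable_def by blast
      then have "AE x in lborel. x \<notin> ?I - {x. poly p x = 0}"
      proof eventually_elim
        case (elim x)
        then show ?case
          using weight_pos[of x \<gamma>] by (cases "x \<in> ?I") auto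
      qed
      moreover have "AE x in lborel. x \<notin> {x. poly p x = 0}"
        using poly_roots_finite[OF that] by (intro AE_not_in finite_imp_null_set_lborel)
      ultimately have "AE x in lborel. x \<notin> ?I"
        by eventually_elim auto
      then have "emeasure lborel ?I = 0"
        by (subst (asm) AE_iff_measurable[OF _ refl]) auto
      moreover have "{0<..<1} \<subseteq> ?I"
        by (cases \<gamma>) auto
      then have "emeasure lborel {0<..<1::real} \<le> emeasure lborel ?I"
        by (intro emeasure_mono) auto
      ultimately show False
        by simp
    qed
    moreover have "moment_functional \<gamma> (p * p) \<ge> 0"
      unfolding moment_functional_def set_lebesgue_integral_def
      using nonneg by (intro Bochner_Integration.integral_nonneg)
    ultimately show ?thesis
      by linarith
  qed
qed

lemma admissible_incr_params: "admissible \<gamma> \<Longrightarrow> admissible (incr_params \<gamma>)"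
  by (cases \<gamma>) auto

lemma moment_mat_eq_gram:
  assumes "admissible \<gamma>"
  shows "moment_mat \<gamma> = definite_functional.gram (moment_functional \<gamma>)"
proof -
  interpret definite_functional "moment_functional \<gamma>"
    by (rule definite_functional_moment_functional[OF assms])
  show ?thesis
    by (simp add: fun_eq_iff moment_mat_def gram_def moment_functional_def poly_monom)
qed

text \<open>
  Existence and uniqueness of the factorization give the definite descriptions behind \<open>S_mat\<close> and
  \<open>H_seq\<close> their meaning.
\<close>

lemma is_LU_moment_mat:
  assumes "admissible \<gamma>"
  shows "is_LU (moment_mat \<gamma>) (S_mat \<gamma>) (H_seq \<gamma>)" "H_seq \<gamma> i > 0"
proof -
  interpret definite_functional "moment_functional \<gamma>"
    by (rule definite_functional_moment_functional[OF assms])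
  note gram = moment_mat_eq_gram[OF assms]
  obtain S h where LU: "is_LU gram S h"
    using is_LU_exists by blast
  have S: "S_mat \<gamma> = S"
    unfolding S_mat_def gram using LU is_LU_unique(1) by blast
  have "H_seq \<gamma> = h"
    unfolding H_seq_def S gram using LU is_LU_unique(2) by blast
  then show "is_LU (moment_mat \<gamma>) (S_mat \<gamma>) (H_seq \<gamma>)" "H_seq \<gamma> i > 0"
    using LU is_LU_pos[OF LU] by (auto simp: S gram)
qed

section \<open>Integration by parts against the Pearson equation\<close>

text \<open>
  The Pearson equation in divergence form: \<open>(q p\<^sub>2 u)' = ((q p\<^sub>2)' + q p\<^sub>1) u\<close>. On the interval, \<open>p\<^sub>2 u\<close> is the
  weight with increased parameters.
\<close>

lemma weight_has_derivative_pearson: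
  assumes "x \<in> weight_interval \<gamma>"
  shows "((\<lambda>x. poly q x * weight (incr_params \<gamma>) x) has_real_derivative
    poly (pderiv (q * pearson2 \<gamma>) + q * pearson1 \<gamma>) x * weight \<gamma> x) (at x)"
proof -
  obtain d where d: "(weight \<gamma> has_real_derivative d) (at x)"
    "poly (pearson2 \<gamma>) x * d = poly (pearson1 \<gamma>) x * weight \<gamma> x"
    using weight_pearson[OF assms] by blast
  have "((\<lambda>x. poly (q * pearson2 \<gamma>) x * weight \<gamma> x) has_real_derivative
      poly (q * pearson2 \<gamma>) x * d + poly (pderiv (q * pearson2 \<gamma>)) x * weight \<gamma> x) (at x)"
    by (rule DERIV_mult'[OF poly_DERIV d(1)])
  also have "poly (q * pearson2 \<gamma>) x * d + poly (pderiv (q * pearson2 \<gamma>)) x * weight \<gamma> x =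
      poly (pderiv (q * pearson2 \<gamma>) + q * pearson1 \<gamma>) x * weight \<gamma> x"
    by (simp add: d(2) mult.assoc distrib_right)
  finally show ?thesis
  proof (rule has_field_derivative_transform_within_open)
    show "open (weight_interval \<gamma>)"
      by (cases \<gamma>) auto
  qed (use assms weight_incr_params in \<open>auto simp: mult_ac\<close>)
qed

lemma tendsto_poly_exp_at_top:
  assumes "eventually (\<lambda>x. \<bar>w x\<bar> \<le> C * x ^ m / exp x) at_top"
  shows "((\<lambda>x. poly p x * w x) \<longlongrightarrow> (0::real)) at_top"
proof -
  have "((\<lambda>x. x ^ k * w x) \<longlongrightarrow> 0) at_top" for k
  proof (rule Lim_null_comparison)
    show "((\<lambda>x. C * (x ^ (k + m) / exp x)) \<longlongrightarrow> 0) at_top"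
      by (rule tendsto_mult_right_zero[OF tendsto_power_div_exp_0])
    show "eventually (\<lambda>x. norm (x ^ k * w x) \<le> C * (x ^ (k + m) / exp x)) at_top"
      using assms eventually_ge_at_top[of 0]
    proof eventually_elim
      case (elim x)
      then show ?case
        using mult_left_mono[OF elim(1), of "x ^ k"] by (simp add: abs_mult power_add mult_ac)
    qed
  qed
  then have "((\<lambda>x. \<Sum>k\<le>degree p. coeff p k * (x ^ k * w x)) \<longlongrightarrow> 0) at_top"
    by (intro tendsto_null_sum tendsto_mult_right_zero)
  then show ?thesis
    by (simp add: poly_altdef sum_distrib_right mult.assoc)
qed

lemma tendsto_poly_Hermite: "((\<lambda>x. poly p x * exp (- (x ^ 2))) \<longlongrightarrow> (0::real)) at_top"
proof (rule tendsto_poly_exp_at_top)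
  show "eventually (\<lambda>x::real. \<bar>exp (- (x ^ 2))\<bar> \<le> 1 * x ^ 0 / exp x) at_top"
    using eventually_ge_at_top[of 1]
    by eventually_elim (simp add: exp_minus field_simps power2_eq_square exp_add[symmetric])
qed

text \<open>
  The integrand is the derivative of \<open>q u\<^bsub>\<gamma>+1\<^esub>\<close>. This function tends to zero at both ends: at a finite
  end because the exponent of the corresponding factor of \<open>u\<^bsub>\<gamma>+1\<^esub>\<close> is positive, the original exponent
  being larger than \<open>-1\<close>; at an infinite end because of the exponential.
\<close>

lemma moment_functional_pearson:
  assumes "admissible \<gamma>"
  shows "moment_functional \<gamma> (pderiv (q * pearson2 \<gamma>) + q * pearson1 \<gamma>) = 0"
proof -
  let ?F = "\<lambda>x. poly q x * weight (incr_params \<gamma>) x"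
  let ?r = "pderiv (q * pearson2 \<gamma>) + q * pearson1 \<gamma>"
  have ibp: "moment_functional \<gamma> ?r = 0"
    if I: "weight_interval \<gamma> = einterval a b" "a < b"
      and lims: "((?F \<circ> real_of_ereal) \<longlongrightarrow> 0) (at_right a)" "((?F \<circ> real_of_ereal) \<longlongrightarrow> 0) (at_left b)"
    for a b
  proof -
    have "(LBINT x=a..b. poly ?r x * weight \<gamma> x) = 0 - 0"
    proof (rule interval_integral_FTC_integrable[OF I(2) _ _ _ lims])
      fix x assume "a < ereal x" "ereal x < b"
      then have x: "x \<in> weight_interval \<gamma>"
        by (simp add: I einterval_iff)
      show "(?F has_vector_derivative poly ?r x * weight \<gamma> x) (at x)"
        using weight_has_derivative_pearson[OF x]
        by (simp add: has_real_derivative_iff_has_vector_derivative)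
      have "isCont (weight \<gamma>) x"
        using weight_pearson[OF x] DERIV_isCont by blast
      then show "isCont (\<lambda>x. poly ?r x * weight \<gamma> x) x"
        by (intro continuous_intros)
    next
      show "set_integrable lborel (einterval a b) (\<lambda>x. poly ?r x * weight \<gamma> x)"
        using poly_weight_integrable[OF assms, of ?r] by (simp only: I)
    qed
    then show ?thesis
      using I(2) unfolding interval_lebesgue_integral_def moment_functional_def I(1)
      by (simp only: less_imp_le if_True diff_self)
  qed
  show ?thesis
  proof (cases \<gamma>)
    case Hermite
    have "((\<lambda>x. poly (q \<circ>\<^sub>p [:0, -1:]) x * exp (- (x ^ 2))) \<longlongrightarrow> 0) at_top"
      by (rule tendsto_poly_Hermite)
    then have "((\<lambda>x. poly q x * exp (- (x ^ 2))) \<longlongrightarrow> 0) at_bot"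
      by (simp add: filterlim_at_bot_mirror poly_pcompose)
    then show ?thesis
      using tendsto_poly_Hermite Hermite
      by (intro ibp[of "-\<infinity>" "\<infinity>"]) (simp_all add: ereal_tendsto_simps)
  next
    case (Laguerre \<alpha>)
    have "((\<lambda>x. poly q x * (x powr (\<alpha> + 1) * exp (- x))) \<longlongrightarrow> poly q 0 * (0 * exp (- 0))) (at_right 0)"
    proof (intro tendsto_intros)
      show "((\<lambda>x. x powr (\<alpha> + 1)) \<longlongrightarrow> 0) (at_right 0)"
        using assms Laguerre by real_asymp
    qed
    moreover have "((\<lambda>x. poly q x * (x powr (\<alpha> + 1) * exp (- x))) \<longlongrightarrow> 0) at_top"
    proof (rule tendsto_poly_exp_at_top)
      show "eventually (\<lambda>x. \<bar>x powr (\<alpha> + 1) * exp (- x)\<bar> \<le> 1 * x ^ nat \<lceil>\<alpha> + 1\<rceil> / exp x) at_top"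
        using eventually_ge_at_top[of 1]
      proof eventually_elim
        case (elim x)
        have "x powr (\<alpha> + 1) \<le> x powr real (nat \<lceil>\<alpha> + 1\<rceil>)"
          using elim by (intro powr_mono) linarith+
        then show ?case
          using elim by (simp add: powr_realpow exp_minus field_simps)
      qed
    qed
    ultimately show ?thesis
      using Laguerre
      by (intro ibp[of 0 "\<infinity>"]) (simp_all add: ereal_tendsto_simps zero_ereal_def)
  next
    case (Jacobi \<alpha> \<beta>)
    have "((\<lambda>x. poly q x * ((1 - x) powr (\<alpha> + 1) * (1 + x) powr (\<beta> + 1))) \<longlongrightarrow>
        poly q (-1) * ((1 - (-1)) powr (\<alpha> + 1) * 0)) (at_right (-1))"
    proof (intro tendsto_intros)
      show "((\<lambda>x. (1 + x) powr (\<beta> + 1)) \<longlongrightarrow> 0) (at_right (-1))"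
        using assms Jacobi by real_asymp
    qed auto
    moreover have "((\<lambda>x. poly q x * ((1 - x) powr (\<alpha> + 1) * (1 + x) powr (\<beta> + 1))) \<longlongrightarrow>
        poly q 1 * (0 * (1 + 1) powr (\<beta> + 1))) (at_left 1)"
    proof (intro tendsto_intros)
      show "((\<lambda>x. (1 - x) powr (\<alpha> + 1)) \<longlongrightarrow> 0) (at_left 1)"
        using assms Jacobi by real_asymp
    qed auto
    ultimately show ?thesis
      using Jacobi
      by (intro ibp[of "ereal (-1)" "ereal 1"]) (simp_all only: ereal_tendsto_simps weight_interval.simps
          incr_params.simps weight.simps einterval_eq ereal_less_eq mult_zero_right mult_zero_left, simp_all)
  qed
qed

lemma moment_functional_incr_params:
  "moment_functional (incr_params \<gamma>) p = moment_functional \<gamma> (p * pearson2 \<gamma>)"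
  unfolding moment_functional_def weight_interval_incr_params
  by (rule set_lebesgue_integral_cong) (auto simp: weight_incr_params)

text \<open>
  The integration by parts formula for \<open>q = x\<^sup>n\<close>.
\<close>

lemma moment_recurrence:
  fixes a b c A B :: real
  assumes "admissible \<gamma>" and p2: "pearson2 \<gamma> = [:c, b, a:]" and p1: "pearson1 \<gamma> = [:B - b, A - 2 * a:]"
  defines "\<mu> \<equiv> \<lambda>n. moment_functional \<gamma> (monom 1 n)"
  shows "real n * c * \<mu> (n - 1) + (B + real n * b) * \<mu> n + (A + real n * a) * \<mu> (n + 1) = 0"
proof -
  interpret definite_functional "moment_functional \<gamma>"
    by (rule definite_functional_moment_functional[OF assms(1)])
  have "pderiv (monom 1 n * pearson2 \<gamma>) + monom 1 n * pearson1 \<gamma> =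
      smult (real n * c) (monom 1 (n - 1)) + smult (B + real n * b) (monom 1 n)
      + smult (A + real n * a) (monom 1 (n + 1))"
    unfolding p1 p2 pderiv_mult pderiv_monom poly_eq_poly_eq_iff[symmetric]
    by (cases n) (auto simp: fun_eq_iff poly_monom pderiv_pCons algebra_simps)
  then show ?thesis
    using moment_functional_pearson[OF assms(1), of "monom 1 n"] by (simp add: \<mu>_def add smult)
qed

section \<open>The derivation matrix and its adjoint\<close>

lemma shift_mat_pow: "smat_pow shift_mat k i j = (if j = i + k then 1 else 0)"
proof (induction k arbitrary: i j)
  case (Suc k)
  have *: "upper_band 1 shift_mat"
    by (auto simp: upper_band_def shift_mat_def)
  have "(shift_mat \<odot> N) i j = N (i + 1) j" for N
    unfolding smat_mult_entry[OF *]
    by (simp add: shift_mat_def if_distrib[of "\<lambda>x. x * _"] cong: if_cong)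
  then show ?case
    by (simp add: Suc)
qed (simp add: smat_id_def smat_diag_def)

lemma smat_poly_shift_mat:
  "smat_poly p shift_mat i j = (if i \<le> j then coeff p (j - i) else 0)"
proof (cases "i \<le> j")
  case True
  have "smat_poly p shift_mat i j = (\<Sum>k\<le>degree p. if k = j - i then coeff p k else 0)"
    unfolding smat_poly_def shift_mat_pow using True by (intro sum.cong) auto
  then show ?thesis
    using True by (simp add: coeff_eq_0)
qed (auto simp: smat_poly_def shift_mat_pow)

lemma deriv_mat_mult: "(deriv_mat \<odot> N) i j = real i * N (i - 1) j"
proof -
  have *: "upper_band 0 deriv_mat"
    by (auto simp: upper_band_def deriv_mat_def)
  show ?thesis
  proof (cases i)
    case (Suc m)
    then have "(deriv_mat \<odot> N) i j = (\<Sum>k\<le>i. if k = m then real i * N k j else 0)"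
      unfolding smat_mult_entry[OF *] by (intro sum.cong) (auto simp: deriv_mat_def)
    then show ?thesis
      using Suc by simp
  qed (unfold smat_mult_entry[OF *], simp add: deriv_mat_def)
qed

text \<open>
  Row \<open>i\<close> lists the coefficients of \<open>p\<^sub>2' x\<^sup>i + p\<^sub>1 x\<^sup>i + i p\<^sub>2 x\<^bsup>i-1\<^esup>\<close>. The entry on the superdiagonal is
  \<open>2 a + (A - 2 a) + i a\<close> and the one on the diagonal is \<open>b + (B - b) + i b\<close>, which explains the
  normalization of \<open>p\<^sub>1\<close>.
\<close>

lemma pearson_mat_entry:
  fixes a b c A B :: real
  defines "p2 \<equiv> [:c, b, a:]" and "p1 \<equiv> [:B - b, A - 2 * a:]"
  shows "(smat_poly (pderiv p2) shift_mat + smat_poly p1 shift_mat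
      + deriv_mat \<odot> smat_poly p2 shift_mat) i j =
    (if j = i + 1 then A + real i * a else if j = i then B + real i * b
     else if i = j + 1 then real i * c else 0)"
proof -
  have p1: "coeff p1 0 = B - b" "coeff p1 (Suc 0) = A - 2 * a" "coeff p1 (Suc (Suc k)) = 0" for k
    by (simp_all add: p1_def)
  have p2': "coeff (pderiv p2) 0 = b" "coeff (pderiv p2) (Suc 0) = 2 * a"
    "coeff (pderiv p2) (Suc (Suc k)) = 0" for k
    by (simp_all add: p2_def pderiv_pCons coeff_pCons split: nat.splits)
  have p2: "coeff p2 0 = c" "coeff p2 (Suc 0) = b" "coeff p2 2 = a"
    "coeff p2 (Suc (Suc (Suc k))) = 0" "coeff p2 (3 + k) = 0" for k
    by (simp_all add: p2_def numeral_eq_Suc)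
  consider d where "j = i + Suc (Suc d)" | "j = i + 1" | "j = i" | "i = j + 1" |
    d where "i = j + Suc (Suc d)"
    by (metis Suc_eq_plus1 add.commute add_Suc_right less_imp_Suc_add linorder_neqE_nat not0_implies_Suc plus_nat.add_0)
  then show ?thesis
  proof cases
    case (1 d)
    then show ?thesis
      by (cases i) (simp_all add: deriv_mat_mult smat_poly_shift_mat p1 p2' p2)
  next
    case 2
    then show ?thesis
      by (cases i) (simp_all add: deriv_mat_mult smat_poly_shift_mat p1 p2' p2)
  next
    case 3
    then show ?thesis
      by (cases i) (simp_all add: deriv_mat_mult smat_poly_shift_mat p1 p2' p2)
  next
    case 4
    then show ?thesis
      by (simp add: deriv_mat_mult smat_poly_shift_mat p2)
  next
    case (5 d)
    then show ?thesis
      by (simp add: deriv_mat_mult smat_poly_shift_mat)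
  qed
qed

text \<open>
  Moments depend only on the sum of the indices: entry \<open>(i, j)\<close> of the sum of the two products is
  the moment recurrence at \<open>n = i + j\<close>, the multiples of \<open>i\<close> in its coefficients coming from the first product and the
  rest from the second.
\<close>

lemma deriv_mat_moment_mat:
  fixes a b c A B :: real
  assumes "admissible \<gamma>" and p2: "pearson2 \<gamma> = [:c, b, a:]" and p1: "pearson1 \<gamma> = [:B - b, A - 2 * a:]"
    and M: "\<And>i j. M i j = (if j = i + 1 then A + real i * a else if j = i then B + real i * b
        else if i = j + 1 then real i * c else 0)"
  shows "deriv_mat \<odot> moment_mat (incr_params \<gamma>) = - (moment_mat \<gamma> \<odot> smat_transpose M)"
proof (intro ext)
  fix i j
  interpret definite_functional "moment_functional \<gamma>"
    by (rule definite_functional_moment_functional[OF assms(1)])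
  interpret incr: definite_functional "moment_functional (incr_params \<gamma>)"
    by (intro definite_functional_moment_functional admissible_incr_params assms(1))
  define \<mu> where "\<mu> = (\<lambda>n. moment_functional \<gamma> (monom 1 n))"
  have bM: "upper_band 1 M"
    by (auto simp: upper_band_def M)
  have G: "moment_mat \<gamma> i j = \<mu> (i + j)" for i j
    by (simp add: moment_mat_eq_gram[OF assms(1)] gram_def \<mu>_def)
  have G': "moment_mat (incr_params \<gamma>) i j = c * \<mu> (i + j) + b * \<mu> (i + j + 1) + a * \<mu> (i + j + 2)" for i j
  proof -
    have "monom 1 (i + j) * pearson2 \<gamma> =
        smult c (monom 1 (i + j)) + smult b (monom 1 (i + j + 1)) + smult a (monom 1 (i + j + 2))"
      unfolding p2 poly_eq_poly_eq_iff[symmetric]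
      by (auto simp: fun_eq_iff poly_monom algebra_simps)
    then show ?thesis
      by (simp add: moment_mat_eq_gram[OF admissible_incr_params[OF assms(1)]] incr.gram_def
          moment_functional_incr_params add smult \<mu>_def)
  qed
  have "(moment_mat \<gamma> \<odot> smat_transpose M) i j = (M \<odot> moment_mat \<gamma>) j i"
    by (simp add: smat_mult_def smat_transpose_def G mult.commute add.commute)
  also have "\<dots> = real j * c * \<mu> (i + j - 1) + (B + real j * b) * \<mu> (i + j) + (A + real j * a) * \<mu> (i + j + 1)"
  proof (cases j)
    case 0
    then show ?thesis
      unfolding smat_mult_entry[OF bM] by (simp add: M G add.commute)
  next
    case (Suc m)
    have "(\<Sum>k\<le>m. M j k * \<mu> (k + i)) = M j m * \<mu> (m + i)"
      by (rule sum_atMost_last) (simp add: M Suc)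
    then show ?thesis
      unfolding smat_mult_entry[OF bM] by (simp add: Suc M G add.commute)
  qed
  finally have GM: "(moment_mat \<gamma> \<odot> smat_transpose M) i j = \<dots>" .
  have "real i * moment_mat (incr_params \<gamma>) (i - 1) j =
      real i * (c * \<mu> (i + j - 1) + b * \<mu> (i + j) + a * \<mu> (i + j + 1))"
    by (cases i) (simp_all add: G')
  then have "(deriv_mat \<odot> moment_mat (incr_params \<gamma>)) i j + (moment_mat \<gamma> \<odot> smat_transpose M) i j =
      real (i + j) * c * \<mu> (i + j - 1) + (B + real (i + j) * b) * \<mu> (i + j)
      + (A + real (i + j) * a) * \<mu> (i + j + 1)"
    unfolding deriv_mat_mult GM by (simp add: algebra_simps)
  also have "\<dots> = 0"
    unfolding \<mu>_def by (rule moment_recurrence[OF assms(1) p2 p1])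
  finally show "(deriv_mat \<odot> moment_mat (incr_params \<gamma>)) i j = (- (moment_mat \<gamma> \<odot> smat_transpose M)) i j"
    by simp
qed

section \<open>Comparison of diagonals\<close>

lemma upper_band_deriv_mat: "upper_band 0 deriv_mat"
  by (auto simp: upper_band_def deriv_mat_def)

text \<open>
  The conjugated derivation matrix is strictly lower triangular. Its first two subdiagonals depend only
  on the first subdiagonals of the triangular factors.
\<close>

lemma deriv_conjugation_entries:
  assumes S: "lower_unitriangular S" and T: "lower_unitriangular T"
  shows "(S \<odot> deriv_mat \<odot> T) n n = 0"
    "(S \<odot> deriv_mat \<odot> T) (Suc n) n = real (Suc n)"
    "(S \<odot> deriv_mat \<odot> T) (Suc (Suc n)) n =
      real (Suc n) * S (Suc (Suc n)) (Suc n) + real (Suc (Suc n)) * T (Suc n) n"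
proof -
  have *: "(S \<odot> deriv_mat \<odot> T) i j = (\<Sum>k\<le>i. S i k * (real k * T (k - 1) j))" for i j
    using upper_band_lower_unitriangular[OF S]
    by (simp add: smat_mult_assoc[OF _ upper_band_deriv_mat] smat_mult_entry deriv_mat_mult)
  have zero: "S i k * (real k * T (k - 1) j) = 0" if "k < Suc j" for i j k
    using that T by (cases k) (auto simp: lower_unitriangular_def)
  show "(S \<odot> deriv_mat \<odot> T) n n = 0"
    unfolding * using zero by (intro sum.neutral) auto
  show "(S \<odot> deriv_mat \<odot> T) (Suc n) n = real (Suc n)"
    unfolding * using S T
    by (subst sum_atMost_last(1)) (use zero in \<open>auto simp: lower_unitriangular_def\<close>)
  show "(S \<odot> deriv_mat \<odot> T) (Suc (Suc n)) n =
      real (Suc n) * S (Suc (Suc n)) (Suc n) + real (Suc (Suc n)) * T (Suc n) n"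
    unfolding * using S T
    by (subst sum_atMost_last(2)) (use zero in \<open>auto simp: lower_unitriangular_def\<close>)
qed

text \<open>
  Multiplication by lower unitriangular matrices preserves the top diagonal, and changes the next one
  only through their first subdiagonals.
\<close>

lemma tridiagonal_conjugation_entries:
  assumes S: "lower_unitriangular S" and T: "lower_unitriangular T" and M: "upper_band 1 M"
  shows "upper_band 1 (S \<odot> M \<odot> T)"
    "(S \<odot> M \<odot> T) n (Suc n) = M n (Suc n)"
    "(S \<odot> M \<odot> T) 0 0 = M 0 0 + M 0 1 * T 1 0"
    "(S \<odot> M \<odot> T) (Suc n) (Suc n) = M (Suc n) (Suc n) + S (Suc n) n * M n (Suc n)
      + M (Suc n) (Suc (Suc n)) * T (Suc (Suc n)) (Suc n)"
proof -
  note bS = upper_band_lower_unitriangular[OF S] and bT = upper_band_lower_unitriangular[OF T]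
  have bSM: "upper_band 1 (S \<odot> M)"
    using upper_band_mult[OF bS M] by simp
  show "upper_band 1 (S \<odot> M \<odot> T)"
    using upper_band_mult[OF bSM bT] by simp
  have top: "(S \<odot> M) n (Suc n) = M n (Suc n)" for n
  proof -
    have "(S \<odot> M) n (Suc n) = S n n * M n (Suc n)"
      unfolding smat_mult_entry[OF bS] add_0_right using M
      by (intro sum_atMost_last) (simp add: upper_band_def)
    then show ?thesis
      using S by (simp add: lower_unitriangular_def)
  qed
  have diag: "(S \<odot> M) 0 0 = M 0 0"
    "(S \<odot> M) (Suc n) (Suc n) = S (Suc n) n * M n (Suc n) + M (Suc n) (Suc n)"
  proof -
    show "(S \<odot> M) 0 0 = M 0 0"
      using S by (simp add: smat_mult_entry[OF bS] lower_unitriangular_def)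
    have "(S \<odot> M) (Suc n) (Suc n) = S (Suc n) n * M n (Suc n) + S (Suc n) (Suc n) * M (Suc n) (Suc n)"
      unfolding smat_mult_entry[OF bS] add_0_right using M
      by (intro sum_atMost_last) (simp add: upper_band_def)
    then show "(S \<odot> M) (Suc n) (Suc n) = S (Suc n) n * M n (Suc n) + M (Suc n) (Suc n)"
      using S by (simp add: lower_unitriangular_def)
  qed
  have T0: "T k m = 0" if "k < m" for k m
    using that T by (simp add: lower_unitriangular_def)
  have T1: "T m m = 1" for m
    using T by (simp add: lower_unitriangular_def)
  have "(S \<odot> M \<odot> T) n (Suc n) = (S \<odot> M) n (Suc n) * T (Suc n) (Suc n)"
    unfolding smat_mult_entry[OF bSM] Suc_eq_plus1[symmetric]
    by (intro sum_atMost_last) (simp add: T0)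
  then show "(S \<odot> M \<odot> T) n (Suc n) = M n (Suc n)"
    by (simp add: T1 top)
  have dd: "(S \<odot> M \<odot> T) m m = (S \<odot> M) m m + M m (Suc m) * T (Suc m) m" for m
  proof -
    have "(S \<odot> M \<odot> T) m m = (S \<odot> M) m m * T m m + (S \<odot> M) m (Suc m) * T (Suc m) m"
      unfolding smat_mult_entry[OF bSM] Suc_eq_plus1[symmetric]
      by (intro sum_atMost_last) (simp add: T0)
    then show ?thesis
      by (simp add: T1 top)
  qed
  show "(S \<odot> M \<odot> T) 0 0 = M 0 0 + M 0 1 * T 1 0"
    by (simp add: dd diag)
  show "(S \<odot> M \<odot> T) (Suc n) (Suc n) = M (Suc n) (Suc n) + S (Suc n) n * M n (Suc n)
      + M (Suc n) (Suc (Suc n)) * T (Suc (Suc n)) (Suc n)"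
    by (simp add: dd diag)
qed

text \<open>
  For the Jacobi weight the value is \<open>- (\<alpha> + \<beta> + 2 + 2 n)\<close>, and \<open>\<alpha> + \<beta> > -2\<close>; for the other weights
  \<open>a = 0\<close> and \<open>A < 0\<close>.
\<close>

lemma pearson_coefficient_nonzero:
  fixes a b c A B :: real
  assumes "admissible \<gamma>" "pearson2 \<gamma> = [:c, b, a:]" "pearson1 \<gamma> = [:B - b, A - 2 * a:]"
  shows "A + 2 * real n * a \<noteq> 0"
proof (cases \<gamma>)
  case Hermite
  then have "a = 0" "A = -2"
    using assms by (auto simp: one_pCons split: if_splits)
  then show ?thesis by simp
next
  case (Laguerre \<alpha>)
  then have "a = 0" "A = -1"
    using assms by (auto split: if_splits)
  then show ?thesis by simp
next
  case (Jacobi \<alpha> \<beta>)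
  then have "a = -1" "A = - (\<alpha> + \<beta> + 2)"
    using assms by (auto split: if_splits)
  moreover have "\<alpha> + \<beta> + 2 + 2 * real n > 0"
    using assms Jacobi by (auto intro: add_pos_nonneg)
  ultimately show ?thesis by simp
qed

theorem proposition26:
  fixes \<gamma> :: classical and a b c A B :: real
  assumes "admissible \<gamma>"
    and "pearson2 \<gamma> = [:c, b, a:]"
    and "pearson1 \<gamma> = [:B - b, A - 2 * a:]"
  shows "S_mat \<gamma> \<odot> deriv_mat \<odot> smat_inv (S_mat (incr_params \<gamma>)) =
      - H_mat \<gamma>
      \<odot> smat_transpose
          (S_mat (incr_params \<gamma>)
           \<odot> (smat_poly (pderiv (pearson2 \<gamma>)) shift_mat + smat_poly (pearson1 \<gamma>) shift_mat
              + deriv_mat \<odot> smat_poly (pearson2 \<gamma>) shift_mat)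
           \<odot> smat_inv (S_mat \<gamma>))
      \<odot> smat_inv (H_mat (incr_params \<gamma>))
    \<and> (\<forall>n. S_mat \<gamma> (n + 1) n = (real n + 1) * ((B + real n * b) / (A + 2 * real n * a)))
    \<and> (\<forall>n\<ge>1. H_seq \<gamma> n = - real n / (A + (real n - 1) * a) * H_seq (incr_params \<gamma>) (n - 1))"
proof -
  define M where "M = smat_poly (pderiv (pearson2 \<gamma>)) shift_mat + smat_poly (pearson1 \<gamma>) shift_mat
      + deriv_mat \<odot> smat_poly (pearson2 \<gamma>) shift_mat"
  define S where "S = S_mat \<gamma>"
  define S' where "S' = S_mat (incr_params \<gamma>)"
  define h where "h = H_seq \<gamma>"
  define h' where "h' = H_seq (incr_params \<gamma>)"
  have LU: "is_LU (moment_mat \<gamma>) S h" and h: "h i > 0" for i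
    unfolding S_def h_def by (fact is_LU_moment_mat[OF assms(1)])+
  have LU': "is_LU (moment_mat (incr_params \<gamma>)) S' h'" and h': "h' i > 0" for i
    unfolding S'_def h'_def by (fact is_LU_moment_mat[OF admissible_incr_params[OF assms(1)]])+
  have S: "lower_unitriangular S" and S': "lower_unitriangular S'"
    using LU LU' by (auto simp: is_LU_def)
  note T = smat_inv_lower_unitriangular(1)[OF S] and T' = smat_inv_lower_unitriangular(1)[OF S']
  have M: "M i j = (if j = i + 1 then A + real i * a else if j = i then B + real i * b
      else if i = j + 1 then real i * c else 0)" for i j
    unfolding M_def assms(2,3) by (rule pearson_mat_entry)
  have bM: "upper_band 1 M"
    by (auto simp: upper_band_def M)
  define X where "X = S' \<odot> M \<odot> smat_inv S"
  note X = tridiagonal_conjugation_entries[OF S' T bM, folded X_def]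
  define Y where "Y = S \<odot> deriv_mat \<odot> smat_inv S'"
  note Y = deriv_conjugation_entries[OF S T', folded Y_def]
  have h'_nz: "h' i \<noteq> 0" for i
    using h'[of i] by simp
  have main: "Y = - smat_diag h \<odot> smat_transpose X \<odot> smat_inv (smat_diag h')"
    unfolding X_def Y_def
    by (rule is_LU_intertwining[OF LU LU' h'_nz upper_band_deriv_mat bM
          deriv_mat_moment_mat[OF assms M]])
  have YX: "Y i j * h' j = - h i * X j i" for i j
    using h'_nz unfolding main smat_inv_diag[OF h'_nz] smat_mult_diag
      smat_mult_minus_left[OF upper_band_diag]
    by (simp add: smat_diag_mult smat_transpose_def)
  have X_diag: "X n n = 0" for n
    using YX[of n n] h[of n] by (simp add: Y(1))
  have h_rec: "(A + real n * a) * h (Suc n) = - real (Suc n) * h' n" for n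
    using YX[of "Suc n" n] by (simp add: Y(2) X(2) M mult.commute) (simp add: algebra_simps)
  have S_rec: "real (Suc n) * S (Suc (Suc n)) (Suc n) = real (Suc (Suc n)) * S' (Suc n) n" for n
  proof -
    have "X n (Suc (Suc n)) = 0"
      using X(1) by (simp add: upper_band_def)
    then have "Y (Suc (Suc n)) n = 0"
      using YX[of "Suc (Suc n)" n] h'_nz[of n] by simp
    then show ?thesis
      by (simp add: Y(3) smat_inv_subdiagonal[OF S'])
  qed
  \<comment> \<open>Eliminating S' from the vanishing of the main diagonal and of the second subdiagonal.\<close>
  have sub: "(A + 2 * real n * a) * S (Suc n) n = (real n + 1) * (B + real n * b)" for n
  proof (cases n)
    case 0
    then show ?thesis
      using X_diag[of 0] smat_inv_subdiagonal[OF S, of 0] by (simp add: X(3) M)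
  next
    case (Suc m)
    have E1: "B + real n * b = (A + real n * a) * S (Suc n) n - S' n m * (A + real m * a)"
      using X_diag[of n] by (simp add: Suc X(4) M smat_inv_subdiagonal[OF S])
    have E2: "(real n + 1) * S' n m = real n * S (Suc n) n"
      using S_rec[of m] by (simp add: Suc)
    have "(real n + 1) * (B + real n * b) =
        (real n + 1) * (A + real n * a) * S (Suc n) n - (real n + 1) * S' n m * (A + real m * a)"
      unfolding E1 by (simp add: algebra_simps)
    also have "\<dots> = (A + 2 * real n * a) * S (Suc n) n"
      unfolding E2 by (simp add: Suc algebra_simps)
    finally show ?thesis ..
  qed
  have "S (n + 1) n = (real n + 1) * ((B + real n * b) / (A + 2 * real n * a))" for n
    using sub[of n] pearson_coefficient_nonzero[OF assms, of n] by (simp add: field_simps)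
  moreover have "h n = - real n / (A + (real n - 1) * a) * h' (n - 1)" if "n \<ge> 1" for n
  proof -
    obtain m where m: "n = Suc m"
      using \<open>n \<ge> 1\<close> by (cases n) auto
    \<comment> \<open>The recurrence itself rules out a zero coefficient, because h' is nonzero.\<close>
    have "A + real m * a \<noteq> 0"
      using h_rec[of m] h'_nz[of m] by auto
    then have "h n = (- real n * h' m) / (A + real m * a)"
      using h_rec[of m] by (simp add: m eq_divide_eq mult.commute)
    then show ?thesis
      by (simp add: m)
  qed
  ultimately show ?thesis
    using main unfolding X_def Y_def M_def S_def S'_def h_def h'_def H_mat_def by blast
qed

end
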